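(* Let $k$ be a field and let $V$ be a $k$-vector space with $\dim(V)=d$. Then $\Lambda^{S^2}_V(n+1)=0$ for all $n>2d$.
   Context: $k$ is a field, $\otimes=\otimes_k$, and $V^{\otimes 0}=k$. **Tensor spaces.** For $m\ge 1$ let $\mathcal T(m)=\mathcal T^{S^2}_V(m)=V^{\otimes \frac{(m-1)(m-2)}{2}}$, with tensor factors indexed by the pairs $(p,q)$ with $1\le p<q\le m-1$. A simple tensor $\otimes_{p<q}(u_{p,q})$ is written as an upper triangular $(m-1)\times(m-1)$ tensor matrix with diagonal entries $1$ and entries $u_{p,q}\in V$ above the diagonal. So $\mathcal T(1)$ and $\mathcal T(2)$ are one-dimensional. For $m,n\ge 1$ let $\mathcal B_V(m,n)=V^{\otimes (m-1)(n-1)}$, with factors indexed by positions in an $(m-1)\times(n-1)$ matrix; simple tensors are $\otimes_{r,s}(w_{r,s})$. Transposition of matrices gives a linear isomorphism $A\mapsto A^{tr}$, $\mathcal B_V(m,n)\to\mathcal B_V(n,m)$. **Operations.** For $m,n\ge1$ and $1\le i\le m$ there is a linear map $\diamond_i:\mathcal T(m)\otimes\mathcal B_V(m,n)\otimes\mathcal T(n)\to\mathcal T(m+n-1)$, defined on simple tensors $x=\otimes(u_{p,q})$, $A=\otimes(w_{r,s})$, $y=\otimes(v_{p,q})$ as follows (scalars are multiplied through when a space is $V^{\otimes 0}=k$). Among the indices $1,\dots,m+n-2$, call $i,\dots,i+n-2$ new and the others old; put $\sigma(p)=p$ for old $p<i$ and $\sigma(p)=p-(n-1)$ for old $p\ge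 i+n-1$. The result $\diamond_i(x,A,y)$ is the simple tensor whose entry in position $(p,q)$, $p<q$, is $u_{\sigma(p),\sigma(q)}$ if $p,q$ are both old; $v_{p-i+1,q-i+1}$ if both are new; and $w_{\sigma(o),\,t-i+1}$ if one of $p,q$ is old, equal to $o$, and the other is new, equal to $t$. **Ideals.** An ideal of $\mathcal T^{S^2}_V$ is a family of subspaces $\mathcal I(m)\subseteq\mathcal T(m)$, $m\ge1$, such that for all $m,n\geq 1$, $x\in\mathcal I(m)$, $y\in\mathcal T(n)$, $A\in\mathcal B_V(m,n)$ we have $\diamond_i(x,A,y)\in\mathcal I(m+n-1)$ for $1\le i\le m$ and $\diamond_i(y,A^{tr},x)\in\mathcal I(m+n-1)$ for $1\le i\le n$. The ideal generated by a set is the smallest ideal containing it. **The exterior GSC-operad.** $\mathcal E^{S^2}_V$ is the ideal generated by all elements $\otimes\begin{pmatrix}1&v&v\\&1&v\\&&1\end{pmatrix}\in\mathcal T(4)$, $v\in V$, and $\Lambda^{S^2}_V(m)=\mathcal T^{S^2}_V(m)/\mathcal E^{S^2}_V(m)$.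
   Formalization: The field k is assumed not to be F_2 (over F_2 the claim fails for every d ≥ 3, e.g. d = 3, n = 7), and the case d = 0, n = 1 is excluded, where Λ(2) = k is non-zero. *)

theory Defs
  imports Complex_Main "HOL-Library.Poly_Mapping" "HOL-Library.FuncSet"
begin

section \<open>Tensor powers of a vector space\<close>

text \<open>
  The vector space \<open>V\<close> is the whole type \<open>'v\<close>, with scalar multiplication
  \<open>s :: 'k \<Rightarrow> 'v \<Rightarrow> 'v\<close>. For a finite set \<open>I\<close> of positions, the tensor power of \<open>V\<close> with factors
  indexed by \<open>I\<close> is the free \<open>'k\<close>-vector space on the families \<open>I \<rightarrow> V\<close> modulo the relations of
  multilinearity. Families are extensional functions (\<open>undefined\<close> outside \<open>I\<close>), so for empty \<open>I\<close> there is
  exactly one family, no relation, and the tensor power is one-dimensional.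
\<close>

type_synonym 'v entries = "nat \<times> nat \<Rightarrow> 'v"
type_synonym ('k, 'v) formal = "'v entries \<Rightarrow>\<^sub>0 'k"
type_synonym ('k, 'v) tensor = "('k, 'v) formal set"

definition fscale :: "'k::field \<Rightarrow> ('k, 'v) formal \<Rightarrow> ('k, 'v) formal" where
  "fscale c x = Poly_Mapping.map ((*) c) x"

lemma lookup_fscale [simp]: "Poly_Mapping.lookup (fscale c x) u = c * Poly_Mapping.lookup x u"
  by (simp add: fscale_def Poly_Mapping.map.rep_eq when_def)

lemma vector_space_fscale: "vector_space fscale"
  by unfold_locales (auto intro!: poly_mapping_eqI simp: lookup_add algebra_simps)

definition formals :: "(nat \<times> nat) set \<Rightarrow> ('k::field, 'v) formal set" where
  "formals I = {x. Poly_Mapping.keys x \<subseteq> (I \<rightarrow>\<^sub>E UNIV)}"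

definition multilinear_relations ::
    "('k::field \<Rightarrow> 'v::ab_group_add \<Rightarrow> 'v) \<Rightarrow> (nat \<times> nat) set \<Rightarrow> ('k, 'v) formal set" where
  "multilinear_relations s I =
     {Poly_Mapping.single (u(j := a + b)) 1
        - (Poly_Mapping.single (u(j := a)) 1 + Poly_Mapping.single (u(j := b)) 1)
        | u j a b. u \<in> I \<rightarrow>\<^sub>E UNIV \<and> j \<in> I}
   \<union> {Poly_Mapping.single (u(j := s c a)) 1 - fscale c (Poly_Mapping.single (u(j := a)) 1)
        | u j c a. u \<in> I \<rightarrow>\<^sub>E UNIV \<and> j \<in> I}"

definition null_formals ::
    "('k::field \<Rightarrow> 'v::ab_group_add \<Rightarrow> 'v) \<Rightarrow> (nat \<times> nat) set \<Rightarrow> ('k, 'v) formal set" where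
  "null_formals s I = module.span fscale (multilinear_relations s I)"

definition tclass ::
    "('k::field \<Rightarrow> 'v::ab_group_add \<Rightarrow> 'v) \<Rightarrow> (nat \<times> nat) set \<Rightarrow> ('k, 'v) formal \<Rightarrow> ('k, 'v) tensor" where
  "tclass s I x = {y \<in> formals I. y - x \<in> null_formals s I}"

definition tensor_power ::
    "('k::field \<Rightarrow> 'v::ab_group_add \<Rightarrow> 'v) \<Rightarrow> (nat \<times> nat) set \<Rightarrow> ('k, 'v) tensor set" where
  "tensor_power s I = tclass s I ` formals I"

definition simple_tensor ::
    "('k::field \<Rightarrow> 'v::ab_group_add \<Rightarrow> 'v) \<Rightarrow> (nat \<times> nat) set \<Rightarrow> 'v entries \<Rightarrow> ('k, 'v) tensor" where
  "simple_tensor s I u = tclass s I (Poly_Mapping.single (restrict u I) 1)"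

text \<open>
  Operations on classes are unions over representatives; as they respect the equivalence, all the
  classes united are equal.
\<close>

definition tzero ::
    "('k::field \<Rightarrow> 'v::ab_group_add \<Rightarrow> 'v) \<Rightarrow> (nat \<times> nat) set \<Rightarrow> ('k, 'v) tensor" where
  "tzero s I = tclass s I 0"

definition tadd ::
    "('k::field \<Rightarrow> 'v::ab_group_add \<Rightarrow> 'v) \<Rightarrow> (nat \<times> nat) set
     \<Rightarrow> ('k, 'v) tensor \<Rightarrow> ('k, 'v) tensor \<Rightarrow> ('k, 'v) tensor" where
  "tadd s I X Y = (\<Union>x\<in>X. \<Union>y\<in>Y. tclass s I (x + y))"

definition tscale ::
    "('k::field \<Rightarrow> 'v::ab_group_add \<Rightarrow> 'v) \<Rightarrow> (nat \<times> nat) set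
     \<Rightarrow> 'k \<Rightarrow> ('k, 'v) tensor \<Rightarrow> ('k, 'v) tensor" where
  "tscale s I c X = (\<Union>x\<in>X. tclass s I (fscale c x))"

definition tensor_subspace ::
    "('k::field \<Rightarrow> 'v::ab_group_add \<Rightarrow> 'v) \<Rightarrow> (nat \<times> nat) set \<Rightarrow> ('k, 'v) tensor set \<Rightarrow> bool" where
  "tensor_subspace s I J \<longleftrightarrow>
     J \<subseteq> tensor_power s I \<and> tzero s I \<in> J \<and>
     (\<forall>X\<in>J. \<forall>Y\<in>J. tadd s I X Y \<in> J) \<and> (\<forall>c. \<forall>X\<in>J. tscale s I c X \<in> J)"

section \<open>The spaces \<open>\<T>(m)\<close> and \<open>\<B>(m,n)\<close> and their operations\<close>

definition tri :: "nat \<Rightarrow> (nat \<times> nat) set" where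
  "tri m = {(p, q). 1 \<le> p \<and> p < q \<and> q \<le> m - 1}"

definition rect :: "nat \<Rightarrow> nat \<Rightarrow> (nat \<times> nat) set" where
  "rect m n = {1..m - 1} \<times> {1..n - 1}"

abbreviation TS :: "('k::field \<Rightarrow> 'v::ab_group_add \<Rightarrow> 'v) \<Rightarrow> nat \<Rightarrow> ('k, 'v) tensor set" where
  "TS s m \<equiv> tensor_power s (tri m)"

abbreviation BS :: "('k::field \<Rightarrow> 'v::ab_group_add \<Rightarrow> 'v) \<Rightarrow> nat \<Rightarrow> nat \<Rightarrow> ('k, 'v) tensor set" where
  "BS s m n \<equiv> tensor_power s (rect m n)"

definition transpose_entries :: "nat \<Rightarrow> nat \<Rightarrow> 'v entries \<Rightarrow> 'v entries" where
  "transpose_entries m n w = restrict (\<lambda>(r, t). w (t, r)) (rect n m)"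

definition transpose_formal :: "nat \<Rightarrow> nat \<Rightarrow> ('k::field, 'v) formal \<Rightarrow> ('k, 'v) formal" where
  "transpose_formal m n a =
     (\<Sum>w\<in>Poly_Mapping.keys a.
        Poly_Mapping.single (transpose_entries m n w) (Poly_Mapping.lookup a w))"

text \<open>The isomorphism from \<open>\<B>(m,n)\<close> to \<open>\<B>(n,m)\<close>.\<close>

definition tensor_transpose ::
    "('k::field \<Rightarrow> 'v::ab_group_add \<Rightarrow> 'v) \<Rightarrow> nat \<Rightarrow> nat \<Rightarrow> ('k, 'v) tensor \<Rightarrow> ('k, 'v) tensor" where
  "tensor_transpose s m n A = (\<Union>a\<in>A. tclass s (rect n m) (transpose_formal m n a))"

definition new_index :: "nat \<Rightarrow> nat \<Rightarrow> nat \<Rightarrow> bool" where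
  "new_index i n p \<longleftrightarrow> i \<le> p \<and> p \<le> i + n - 2"

text \<open>Only applied to old indices \<open>p\<close>, that is, \<open>p < i\<close> or \<open>i + n - 1 \<le> p\<close>.\<close>

definition old_pos :: "nat \<Rightarrow> nat \<Rightarrow> nat \<Rightarrow> nat" where
  "old_pos i n p = (if p < i then p else p - (n - 1))"

definition diamond_entries ::
    "nat \<Rightarrow> nat \<Rightarrow> nat \<Rightarrow> 'v entries \<Rightarrow> 'v entries \<Rightarrow> 'v entries \<Rightarrow> 'v entries" where
  "diamond_entries i m n u w v = restrict
     (\<lambda>(p, q).
        if \<not> new_index i n p \<and> \<not> new_index i n q then u (old_pos i n p, old_pos i n q)
        else if new_index i n p \<and> new_index i n q then v (p - i + 1, q - i + 1)
        else if new_index i n q then w (old_pos i n p, q - i + 1)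
        else w (old_pos i n q, p - i + 1))
     (tri (m + n - 1))"

definition diamond_formal ::
    "nat \<Rightarrow> nat \<Rightarrow> nat \<Rightarrow> ('k::field, 'v) formal \<Rightarrow> ('k, 'v) formal \<Rightarrow> ('k, 'v) formal
     \<Rightarrow> ('k, 'v) formal" where
  "diamond_formal i m n x a y =
     (\<Sum>u\<in>Poly_Mapping.keys x. \<Sum>w\<in>Poly_Mapping.keys a. \<Sum>v\<in>Poly_Mapping.keys y.
        Poly_Mapping.single (diamond_entries i m n u w v)
          (Poly_Mapping.lookup x u * Poly_Mapping.lookup a w * Poly_Mapping.lookup y v))"

definition diamond ::
    "('k::field \<Rightarrow> 'v::ab_group_add \<Rightarrow> 'v) \<Rightarrow> nat \<Rightarrow> nat \<Rightarrow> nat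
     \<Rightarrow> ('k, 'v) tensor \<Rightarrow> ('k, 'v) tensor \<Rightarrow> ('k, 'v) tensor \<Rightarrow> ('k, 'v) tensor" where
  "diamond s i m n X A Y =
     (\<Union>x\<in>X. \<Union>a\<in>A. \<Union>y\<in>Y. tclass s (tri (m + n - 1)) (diamond_formal i m n x a y))"

section \<open>Ideals and the exterior GSC-operad\<close>

text \<open>A family is indexed by all natural numbers, but its value at \<open>0\<close> carries no meaning.\<close>

definition is_ideal ::
    "('k::field \<Rightarrow> 'v::ab_group_add \<Rightarrow> 'v) \<Rightarrow> (nat \<Rightarrow> ('k, 'v) tensor set) \<Rightarrow> bool" where
  "is_ideal s J \<longleftrightarrow>
     (\<forall>m\<ge>1. tensor_subspace s (tri m) (J m)) \<and>
     (\<forall>m\<ge>1. \<forall>n\<ge>1. \<forall>X\<in>J m. \<forall>Y\<in>TS s n. \<forall>A\<in>BS s m n.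
        (\<forall>i\<in>{1..m}. diamond s i m n X A Y \<in> J (m + n - 1)) \<and>
        (\<forall>i\<in>{1..n}. diamond s i n m Y (tensor_transpose s m n A) X \<in> J (m + n - 1)))"

definition generated_ideal ::
    "('k::field \<Rightarrow> 'v::ab_group_add \<Rightarrow> 'v) \<Rightarrow> (nat \<Rightarrow> ('k, 'v) tensor set)
     \<Rightarrow> nat \<Rightarrow> ('k, 'v) tensor set" where
  "generated_ideal s G m = \<Inter> {J m | J. is_ideal s J \<and> (\<forall>l\<ge>1. G l \<subseteq> J l)}"

definition exterior_generators ::
    "('k::field \<Rightarrow> 'v::ab_group_add \<Rightarrow> 'v) \<Rightarrow> nat \<Rightarrow> ('k, 'v) tensor set" where
  "exterior_generators s m = (if m = 4 then {simple_tensor s (tri 4) (\<lambda>_. v) | v. True} else {})"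

definition exterior_ideal ::
    "('k::field \<Rightarrow> 'v::ab_group_add \<Rightarrow> 'v) \<Rightarrow> nat \<Rightarrow> ('k, 'v) tensor set" where
  "exterior_ideal s = generated_ideal s (exterior_generators s)"

text \<open>The quotient, as the set of cosets; its zero element is the coset \<open>exterior_ideal s m\<close>.\<close>

definition exterior_operad ::
    "('k::field \<Rightarrow> 'v::ab_group_add \<Rightarrow> 'v) \<Rightarrow> nat \<Rightarrow> ('k, 'v) tensor set set" where
  "exterior_operad s m = (\<lambda>X. tadd s (tri m) X ` exterior_ideal s m) ` TS s m"

end

theory Submission
  imports Defs
begin

text \<open>
  View a simple tensor in \<open>\<T>(n + 1)\<close> as a labelling of the edges of the complete graph on \<open>1, \<dots>, n\<close> by
  vectors. Inserting one vertex at a time shows that the ideal contains every labelling with a triangle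
  labelled \<open>v, v, v\<close>. As \<open>k\<close> has more than two elements, polarization gives
  \<open>aab + aba + baa = 0\<close> for the labels of a triangle. If \<open>p, q, r, \<dots>\<close> is a cycle with all edges
  labelled \<open>a\<close>, this relation for \<open>pqr\<close> replaces the tensor by two tensors in which \<open>pr\<close> is labelled
  \<open>a\<close>, so the cycle gets shorter, until it is a triangle. Hence labellings with a monochromatic cycle
  vanish. By multilinearity it suffices to label by \<open>d\<close> basis vectors; since \<open>n(n - 1)/2 \<ge> d n\<close>,
  some label occurs on at least \<open>n\<close> edges (in the case \<open>d = 0\<close> there is no labelling at all), and
  \<open>n\<close> edges on \<open>n\<close> vertices contain a cycle.
\<close>

section \<open>Calculus of tensor classes\<close>

interpretation fs: vector_space fscale
  by (rule vector_space_fscale)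

lemma fscale_single [simp]: "fscale c (Poly_Mapping.single u b) = Poly_Mapping.single u (c * b)"
  by (rule poly_mapping_eqI) (simp add: lookup_single when_def)

lemma subspace_formals: "fs.subspace (formals I)"
  unfolding formals_def
proof (rule fs.subspaceI, goal_cases)
  case (2 x y)
  then show ?case using keys_add[of x y] by blast
next
  case (3 c x)
  have "Poly_Mapping.keys (fscale c x) \<subseteq> Poly_Mapping.keys x"
    by (auto simp: in_keys_iff)
  then show ?case using 3 by blast
qed simp

lemma single_in_formals: "u \<in> I \<rightarrow>\<^sub>E UNIV \<Longrightarrow> Poly_Mapping.single u c \<in> formals I"
  by (simp add: formals_def)

lemma subspace_null_formals: "fs.subspace (null_formals s I)"
  unfolding null_formals_def by (rule fs.subspace_span)

lemma tclass_self: "x \<in> formals I \<Longrightarrow> x \<in> tclass s I x"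
  unfolding tclass_def using fs.subspace_0[OF subspace_null_formals, of s I] by simp

lemma tclass_eqI:
  assumes "x - y \<in> null_formals s I"
  shows "tclass s I x = tclass s I y"
proof -
  have "z - x \<in> null_formals s I \<longleftrightarrow> z - y \<in> null_formals s I" for z
    using fs.subspace_add[OF subspace_null_formals _ assms, of "z - x"]
      fs.subspace_diff[OF subspace_null_formals _ assms, of "z - y"] by auto
  then show ?thesis by (simp add: tclass_def)
qed

lemma tclassD:
  assumes "y \<in> tclass s I x"
  shows "y \<in> formals I" "y - x \<in> null_formals s I"
  using assms by (auto simp: tclass_def)

text \<open>A change of representatives alters the sum by an element of \<open>null_formals\<close>,
  so the classes united in \<open>tadd\<close> agree. Membership in \<open>formals I\<close> keeps
  the index sets of the union nonempty.\<close>

lemma tadd_tclass: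
  assumes "x \<in> formals I" "y \<in> formals I"
  shows "tadd s I (tclass s I x) (tclass s I y) = tclass s I (x + y)"
proof -
  have "tclass s I (x' + y') = tclass s I (x + y)"
    if "x' \<in> tclass s I x" "y' \<in> tclass s I y" for x' y'
  proof (rule tclass_eqI)
    have "(x' - x) + (y' - y) \<in> null_formals s I"
      by (rule fs.subspace_add[OF subspace_null_formals]) (use that tclassD in blast)+
    then show "x' + y' - (x + y) \<in> null_formals s I" by (simp add: algebra_simps)
  qed
  then show ?thesis
    unfolding tadd_def by (intro UN_constant_eq[OF tclass_self] ballI assms)
qed

lemma tscale_tclass:
  assumes "x \<in> formals I"
  shows "tscale s I c (tclass s I x) = tclass s I (fscale c x)"
proof -
  have "tclass s I (fscale c x') = tclass s I (fscale c x)" if "x' \<in> tclass s I x" for x'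
  proof (rule tclass_eqI)
    have "fscale c (x' - x) \<in> null_formals s I"
      by (rule fs.subspace_scale[OF subspace_null_formals]) (use that tclassD in blast)
    then show "fscale c x' - fscale c x \<in> null_formals s I" by (simp add: fs.scale_right_diff_distrib)
  qed
  then show ?thesis
    unfolding tscale_def by (intro UN_constant_eq[OF tclass_self] ballI assms)
qed

lemma tensor_subspace_tensor_power: "tensor_subspace s I (tensor_power s I)"
  unfolding tensor_subspace_def tensor_power_def tzero_def
  using fs.subspace_0[OF subspace_formals] fs.subspace_add[OF subspace_formals]
    fs.subspace_scale[OF subspace_formals]
  by (auto simp: tadd_tclass tscale_tclass intro!: imageI)

text \<open>The linear extension of a map of families to formal sums. Transposition and the products
  are built from it, so one descent argument serves them all.\<close>

definition push :: "('v entries \<Rightarrow> 'w entries) \<Rightarrow> ('k::field, 'v) formal \<Rightarrow> ('k, 'w) formal" where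
  "push f x = (\<Sum>u\<in>Poly_Mapping.keys x. Poly_Mapping.single (f u) (Poly_Mapping.lookup x u))"

text \<open>Families outside the keys have coefficient 0. This allows several formal sums to be
  pushed over a common index set, from which linearity follows.\<close>

lemma push_superset:
  assumes "finite A" "Poly_Mapping.keys x \<subseteq> A"
  shows "push f x = (\<Sum>u\<in>A. Poly_Mapping.single (f u) (Poly_Mapping.lookup x u))"
  unfolding push_def by (rule sum.mono_neutral_left) (use assms in \<open>auto simp: in_keys_iff\<close>)

lemma push_single [simp]: "push f (Poly_Mapping.single u c) = Poly_Mapping.single (f u) c"
  by (subst push_superset[of "{u}"]) auto

lemma push_add: "push f (x + y) = push f x + push f y"
proof -
  let ?A = "Poly_Mapping.keys x \<union> Poly_Mapping.keys y"
  show ?thesis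
    using keys_add[of x y]
    by (simp add: push_superset[of ?A] lookup_add single_add sum.distrib)
qed

lemma push_fscale: "push f (fscale c x) = fscale c (push f x)"
proof -
  have "Poly_Mapping.keys (fscale c x) \<subseteq> Poly_Mapping.keys x"
    by (auto simp: in_keys_iff)
  then show ?thesis
    by (simp add: push_superset[of "Poly_Mapping.keys x"] fs.scale_sum_right)
qed

lemma push_0 [simp]: "push f 0 = 0"
  by (simp add: push_def)

lemma push_diff: "push f (x - y) = push f x - push f y"
  using push_add[of f "x - y" y] by simp

text \<open>By \<open>upd\<close>, position \<open>j\<close> of the argument feeds position
  \<open>j'\<close> of the result, the same one for all families. A relation of multilinearity at
  \<open>j\<close> therefore goes to one at \<open>j'\<close>, and linearity of \<open>push\<close>
  extends this to the span.\<close>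

lemma push_null_formals:
  assumes f: "\<And>u. u \<in> I \<rightarrow>\<^sub>E UNIV \<Longrightarrow> f u \<in> K \<rightarrow>\<^sub>E UNIV"
    and upd: "\<And>j. j \<in> I \<Longrightarrow> \<exists>j'\<in>K. \<forall>u a. f (u(j := a)) = (f u)(j' := a)"
    and x: "x \<in> null_formals s I"
  shows "push f x \<in> null_formals s K"
  using x unfolding null_formals_def
proof (induction rule: fs.span_induct)
  case base
  show ?case
    using fs.subspace_0[OF subspace_null_formals] fs.subspace_add[OF subspace_null_formals]
      fs.subspace_scale[OF subspace_null_formals]
    by (auto intro!: fs.subspaceI simp: push_add push_fscale null_formals_def)
next
  case (step x)
  then consider
    u j a b where "u \<in> I \<rightarrow>\<^sub>E UNIV" "j \<in> I"
      "x = Poly_Mapping.single (u(j := a + b)) 1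
        - (Poly_Mapping.single (u(j := a)) 1 + Poly_Mapping.single (u(j := b)) 1)"
  | u j c a where "u \<in> I \<rightarrow>\<^sub>E UNIV" "j \<in> I"
      "x = Poly_Mapping.single (u(j := s c a)) 1 - fscale c (Poly_Mapping.single (u(j := a)) 1)"
    unfolding multilinear_relations_def by blast
  then have "push f x \<in> multilinear_relations s K"
  proof cases
    case 1
    with upd obtain j' where j': "j' \<in> K" "\<forall>u a. f (u(j := a)) = (f u)(j' := a)" by blast
    show ?thesis
      unfolding multilinear_relations_def 1(3) push_diff push_add push_single
      using j' f[OF 1(1)] by (intro UnI1 CollectI exI[of _ "f u"] exI[of _ j'] exI[of _ a] exI[of _ b]) simp
  next
    case 2
    with upd obtain j' where j': "j' \<in> K" "\<forall>u a. f (u(j := a)) = (f u)(j' := a)" by blast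
    have "push f x = Poly_Mapping.single ((f u)(j' := s c a)) 1
        - fscale c (Poly_Mapping.single ((f u)(j' := a)) 1)"
      using 2 j' by (simp add: push_diff push_fscale del: fscale_single)
    then show ?thesis
      unfolding multilinear_relations_def using j' f[OF 2(1)]
      by (intro UnI2) blast
  qed
  then show ?case by (rule fs.span_base)
qed

section \<open>Well-definedness of the operations\<close>

lemma transpose_formal_eq: "transpose_formal m n a = push (transpose_entries m n) a"
  by (simp add: transpose_formal_def push_def)

lemma transpose_entries_upd:
  assumes "j \<in> rect m n"
  shows "\<exists>j'\<in>rect n m. \<forall>u a. transpose_entries m n (u(j := a)) = (transpose_entries m n u)(j' := a)"
proof (intro bexI allI ext)
  show "(snd j, fst j) \<in> rect n m"
    using assms by (auto simp: rect_def)
  fix u a and pq :: "nat \<times> nat"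
  obtain p q where pq: "pq = (p, q)" by force
  have "(q, p) = j \<longleftrightarrow> pq = (snd j, fst j)"
    using pq by (cases j) auto
  with \<open>(snd j, fst j) \<in> rect n m\<close>
  show "transpose_entries m n (u(j := a)) pq = ((transpose_entries m n u)((snd j, fst j) := a)) pq"
    unfolding transpose_entries_def pq restrict_def fun_upd_apply by simp
qed

lemma tensor_transpose_tclass:
  assumes "a \<in> formals (rect m n)"
  shows "tensor_transpose s m n (tclass s (rect m n) a) = tclass s (rect n m) (transpose_formal m n a)"
proof -
  have "tclass s (rect n m) (transpose_formal m n a') = tclass s (rect n m) (transpose_formal m n a)"
    if "a' \<in> tclass s (rect m n) a" for a'
  proof (rule tclass_eqI)
    have "push (transpose_entries m n) (a' - a) \<in> null_formals s (rect n m)"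
      by (rule push_null_formals[OF _ transpose_entries_upd tclassD(2)[OF that]])
        (auto simp: transpose_entries_def)
    then show "transpose_formal m n a' - transpose_formal m n a \<in> null_formals s (rect n m)"
      by (simp add: transpose_formal_eq push_diff)
  qed
  then show ?thesis
    unfolding tensor_transpose_def by (intro UN_constant_eq[OF tclass_self] ballI assms)
qed

section \<open>Positions of the factors inside a product\<close>

lemma diamond_entries_PiE: "diamond_entries i m n u w v \<in> tri (m + n - 1) \<rightarrow>\<^sub>E UNIV"
  unfolding diamond_entries_def by (rule restrict_PiE_iff[THEN iffD2]) simp

text \<open>Right inverse of \<open>old_pos\<close>.\<close>

definition old_index :: "nat \<Rightarrow> nat \<Rightarrow> nat \<Rightarrow> nat" where
  "old_index i n p = (if p < i then p else p + (n - 1))"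

lemma old_pos_eq_iff:
  assumes "1 \<le> i" "1 \<le> n" "\<not> new_index i n p"
  shows "old_pos i n p = a \<longleftrightarrow> p = old_index i n a"
  using assms by (auto simp: old_pos_def old_index_def new_index_def)

lemma not_new_index_old_index:
  assumes "1 \<le> i" "1 \<le> n"
  shows "\<not> new_index i n (old_index i n a)"
  using assms by (auto simp: old_index_def new_index_def)

lemma new_index_shift:
  assumes "1 \<le> i" "b \<in> {1..n - 1}"
  shows "new_index i n (b + i - 1)"
  using assms by (auto simp: new_index_def)

lemma new_index_eq_iff:
  assumes "1 \<le> i" "1 \<le> b" "new_index i n p"
  shows "p - i + 1 = b \<longleftrightarrow> p = b + i - 1"
  using assms by (auto simp: new_index_def)

lemma diamond_entries_apply:
  assumes "(p, q) \<in> tri (m + n - 1)"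
  shows "\<not> new_index i n p \<Longrightarrow> \<not> new_index i n q
      \<Longrightarrow> diamond_entries i m n u w v (p, q) = u (old_pos i n p, old_pos i n q)"
    and "new_index i n p \<Longrightarrow> new_index i n q
      \<Longrightarrow> diamond_entries i m n u w v (p, q) = v (p - i + 1, q - i + 1)"
    and "\<not> new_index i n p \<Longrightarrow> new_index i n q
      \<Longrightarrow> diamond_entries i m n u w v (p, q) = w (old_pos i n p, q - i + 1)"
    and "new_index i n p \<Longrightarrow> \<not> new_index i n q
      \<Longrightarrow> diamond_entries i m n u w v (p, q) = w (old_pos i n q, p - i + 1)"
  using assms by (simp_all add: diamond_entries_def)

lemma diamond_entries_outside:
  assumes "pq \<notin> tri (m + n - 1)"
  shows "diamond_entries i m n u w v pq = undefined"
  using assms by (simp add: diamond_entries_def)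

text \<open>An entry of the first factor joins two old vertices and is copied to a single place of
  the product, namely the one obtained by renumbering both vertices with
  \<open>old_index\<close>.\<close>

lemma diamond_entries_upd_left:
  assumes j: "j \<in> tri m" and i: "1 \<le> i" and n: "1 \<le> n"
  shows "\<exists>j'\<in>tri (m + n - 1). \<forall>u a.
    diamond_entries i m n (u(j := a)) w v = (diamond_entries i m n u w v)(j' := a)"
proof (intro bexI allI ext)
  let ?j' = "(old_index i n (fst j), old_index i n (snd j))"
  show j': "?j' \<in> tri (m + n - 1)"
    using assms by (auto simp: tri_def old_index_def)
  fix u a and pq :: "nat \<times> nat"
  obtain p q where pq: "pq = (p, q)" by force
  have old: "pq = ?j' \<longleftrightarrow> (old_pos i n p, old_pos i n q) = j"
    if "\<not> new_index i n p" "\<not> new_index i n q"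
    using that old_pos_eq_iff[OF i n] unfolding pq by (metis fst_conv snd_conv prod.collapse)
  have new: "pq \<noteq> ?j'" if "new_index i n p \<or> new_index i n q"
    using that not_new_index_old_index[OF i n] unfolding pq by blast
  show "diamond_entries i m n (u(j := a)) w v pq = ((diamond_entries i m n u w v)(?j' := a)) pq"
  proof (cases "pq \<in> tri (m + n - 1)")
    case True
    note D = diamond_entries_apply[OF True[unfolded pq]]
    show ?thesis
      using old new True unfolding pq
      by (cases "new_index i n p"; cases "new_index i n q") (simp_all only: D fun_upd_apply simp_thms if_True if_False if_cancel)
  next
    case False
    with j' have "pq \<noteq> ?j'" by blast
    then show ?thesis by (simp add: diamond_entries_outside[OF False] del: One_nat_def)
  qed
qed

lemma diamond_entries_upd_right:
  assumes j: "j \<in> tri n" and i: "1 \<le> i" "i \<le> m" and n: "1 \<le> n"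
  shows "\<exists>j'\<in>tri (m + n - 1). \<forall>v a.
    diamond_entries i m n u w (v(j := a)) = (diamond_entries i m n u w v)(j' := a)"
proof (intro bexI allI ext)
  let ?j' = "(fst j + i - 1, snd j + i - 1)"
  show j': "?j' \<in> tri (m + n - 1)"
    using assms by (auto simp: tri_def)
  have fst: "fst j \<in> {1..n - 1}" and snd: "snd j \<in> {1..n - 1}"
    using j by (auto simp: tri_def)
  fix v a and pq :: "nat \<times> nat"
  obtain p q where pq: "pq = (p, q)" by force
  have new: "pq = ?j' \<longleftrightarrow> (p - i + 1, q - i + 1) = j"
    if "new_index i n p" "new_index i n q"
    using that new_index_eq_iff[OF i(1)] fst snd unfolding pq
    by (metis atLeastAtMost_iff fst_conv snd_conv prod.collapse)
  have old: "pq \<noteq> ?j'" if "\<not> new_index i n p \<or> \<not> new_index i n q"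
    using that new_index_shift[OF i(1)] fst snd unfolding pq by blast
  show "diamond_entries i m n u w (v(j := a)) pq = ((diamond_entries i m n u w v)(?j' := a)) pq"
  proof (cases "pq \<in> tri (m + n - 1)")
    case True
    note D = diamond_entries_apply[OF True[unfolded pq]]
    show ?thesis
      using new old True unfolding pq
      by (cases "new_index i n p"; cases "new_index i n q") (simp_all only: D fun_upd_apply simp_thms if_True if_False if_cancel)
  next
    case False
    with j' have "pq \<noteq> ?j'" by blast
    then show ?thesis by (simp add: diamond_entries_outside[OF False] del: One_nat_def)
  qed
qed

lemma diamond_entries_upd_mid:
  assumes j: "j \<in> rect m n" and i: "1 \<le> i" "i \<le> m" and n: "1 \<le> n"
  shows "\<exists>j'\<in>tri (m + n - 1). \<forall>w a.
    diamond_entries i m n u (w(j := a)) v = (diamond_entries i m n u w v)(j' := a)"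
proof (intro bexI allI ext)
  \<comment> \<open>An entry of the middle factor joins an old vertex \<open>?o\<close> to a new one
    \<open>?t\<close>. The old vertex may lie before or after the new block, so \<open>min\<close>
    and \<open>max\<close> restore the upper triangular order.\<close>
  let ?o = "old_index i n (fst j)" and ?t = "snd j + i - 1"
  let ?j' = "(min ?o ?t, max ?o ?t)"
  have snd: "snd j \<in> {1..n - 1}"
    using j by (auto simp: rect_def)
  have o: "\<not> new_index i n ?o" and t: "new_index i n ?t"
    using not_new_index_old_index[OF i(1) n] new_index_shift[OF i(1) snd] by auto
  then have "?o \<noteq> ?t" by metis
  then show j': "?j' \<in> tri (m + n - 1)"
    using assms by (auto simp: tri_def rect_def old_index_def min_def max_def)
  fix w a and pq :: "nat \<times> nat"
  obtain p q where pq: "pq = (p, q)" by force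
  have same: "pq \<noteq> ?j'" if "new_index i n p \<longleftrightarrow> new_index i n q"
    using that o t unfolding pq by (metis Pair_inject min_def max_def)
  have eq: "x = ?o \<and> y = ?t \<longleftrightarrow> (old_pos i n x, y - i + 1) = j"
    if "\<not> new_index i n x" "new_index i n y" for x y
    using old_pos_eq_iff[OF i(1) n that(1)] new_index_eq_iff[OF i(1) _ that(2)] snd
    by (metis atLeastAtMost_iff fst_conv snd_conv prod.collapse)
  have mm: "pq = ?j' \<longleftrightarrow> (p = ?o \<and> q = ?t) \<or> (q = ?o \<and> p = ?t)" if "pq \<in> tri (m + n - 1)"
    using that unfolding pq tri_def by (auto simp: min_def max_def)
  have on: "pq = ?j' \<longleftrightarrow> (old_pos i n p, q - i + 1) = j"
    if "pq \<in> tri (m + n - 1)" "\<not> new_index i n p" "new_index i n q"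
    using mm[OF that(1)] eq[OF that(2,3)] that o t by metis
  have no: "pq = ?j' \<longleftrightarrow> (old_pos i n q, p - i + 1) = j"
    if "pq \<in> tri (m + n - 1)" "new_index i n p" "\<not> new_index i n q"
    using mm[OF that(1)] eq[OF that(3,2)] that o t by metis
  show "diamond_entries i m n u (w(j := a)) v pq = ((diamond_entries i m n u w v)(?j' := a)) pq"
  proof (cases "pq \<in> tri (m + n - 1)")
    case True
    note D = diamond_entries_apply[OF True[unfolded pq]]
    show ?thesis
      using same on no True unfolding pq
      by (cases "new_index i n p"; cases "new_index i n q") (simp_all only: D fun_upd_apply simp_thms if_True if_False if_cancel)
  next
    case False
    with j' have "pq \<noteq> ?j'" by blast
    then show ?thesis by (simp add: diamond_entries_outside[OF False] del: One_nat_def)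
  qed
qed

section \<open>Trilinearity and descent to tensor classes\<close>

lemma diamond_formal_left:
  "diamond_formal i m n x a y =
    (\<Sum>w\<in>Poly_Mapping.keys a. \<Sum>v\<in>Poly_Mapping.keys y.
      fscale (Poly_Mapping.lookup a w * Poly_Mapping.lookup y v) (push (\<lambda>u. diamond_entries i m n u w v) x))"
proof -
  have "diamond_formal i m n x a y =
    (\<Sum>w\<in>Poly_Mapping.keys a. \<Sum>u\<in>Poly_Mapping.keys x. \<Sum>v\<in>Poly_Mapping.keys y.
        Poly_Mapping.single (diamond_entries i m n u w v)
          (Poly_Mapping.lookup x u * Poly_Mapping.lookup a w * Poly_Mapping.lookup y v))"
    unfolding diamond_formal_def by (rule sum.swap)
  also have "\<dots> = (\<Sum>w\<in>Poly_Mapping.keys a. \<Sum>v\<in>Poly_Mapping.keys y. \<Sum>u\<in>Poly_Mapping.keys x.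
        Poly_Mapping.single (diamond_entries i m n u w v)
          (Poly_Mapping.lookup x u * Poly_Mapping.lookup a w * Poly_Mapping.lookup y v))"
    by (intro sum.cong refl sum.swap)
  finally show ?thesis
    by (simp add: push_def fs.scale_sum_right ac_simps)
qed

lemma diamond_formal_mid:
  "diamond_formal i m n x a y =
    (\<Sum>u\<in>Poly_Mapping.keys x. \<Sum>v\<in>Poly_Mapping.keys y.
      fscale (Poly_Mapping.lookup x u * Poly_Mapping.lookup y v) (push (\<lambda>w. diamond_entries i m n u w v) a))"
proof -
  have "diamond_formal i m n x a y =
    (\<Sum>u\<in>Poly_Mapping.keys x. \<Sum>v\<in>Poly_Mapping.keys y. \<Sum>w\<in>Poly_Mapping.keys a.
        Poly_Mapping.single (diamond_entries i m n u w v)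
          (Poly_Mapping.lookup x u * Poly_Mapping.lookup a w * Poly_Mapping.lookup y v))"
    unfolding diamond_formal_def by (intro sum.cong refl sum.swap)
  then show ?thesis
    by (simp add: push_def fs.scale_sum_right ac_simps)
qed

lemma diamond_formal_right:
  "diamond_formal i m n x a y =
    (\<Sum>u\<in>Poly_Mapping.keys x. \<Sum>w\<in>Poly_Mapping.keys a.
      fscale (Poly_Mapping.lookup x u * Poly_Mapping.lookup a w) (push (\<lambda>v. diamond_entries i m n u w v) y))"
  by (simp add: diamond_formal_def push_def fs.scale_sum_right ac_simps)

lemma diamond_formal_diff:
  "diamond_formal i m n (x - x') a y = diamond_formal i m n x a y - diamond_formal i m n x' a y"
  "diamond_formal i m n x (a - a') y = diamond_formal i m n x a y - diamond_formal i m n x a' y"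
  "diamond_formal i m n x a (y - y') = diamond_formal i m n x a y - diamond_formal i m n x a y'"
  subgoal by (simp only: diamond_formal_left push_diff fs.scale_right_diff_distrib sum_subtractf)
  subgoal by (simp only: diamond_formal_mid push_diff fs.scale_right_diff_distrib sum_subtractf)
  subgoal by (simp only: diamond_formal_right push_diff fs.scale_right_diff_distrib sum_subtractf)
  done

lemma diamond_formal_single:
  "diamond_formal i m n (Poly_Mapping.single u 1) (Poly_Mapping.single w 1) (Poly_Mapping.single v 1)
    = Poly_Mapping.single (diamond_entries i m n u w v) 1"
  by (simp add: diamond_formal_def)

lemma diamond_formal_formals: "diamond_formal i m n x a y \<in> formals (tri (m + n - 1))"
  unfolding diamond_formal_def
  by (intro fs.subspace_sum[OF subspace_formals] single_in_formals diamond_entries_PiE)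

text \<open>With two factors fixed, the product is a combination of images of the third under
  \<open>push\<close>, along maps that send each position to one position. Hence
  \<open>push_null_formals\<close> applies to one factor at a time.\<close>

lemma diamond_formal_null:
  assumes "1 \<le> i" "i \<le> m" "1 \<le> n"
  shows "x \<in> null_formals s (tri m) \<Longrightarrow> diamond_formal i m n x a y \<in> null_formals s (tri (m + n - 1))"
    and "a \<in> null_formals s (rect m n) \<Longrightarrow> diamond_formal i m n x a y \<in> null_formals s (tri (m + n - 1))"
    and "y \<in> null_formals s (tri n) \<Longrightarrow> diamond_formal i m n x a y \<in> null_formals s (tri (m + n - 1))"
proof -
  note sub = subspace_null_formals[of s "tri (m + n - 1)"]
  show "diamond_formal i m n x a y \<in> null_formals s (tri (m + n - 1))"
    if "x \<in> null_formals s (tri m)"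
    unfolding diamond_formal_left
    by (intro fs.subspace_sum[OF sub] fs.subspace_scale[OF sub] push_null_formals[OF _ _ that]
        diamond_entries_PiE diamond_entries_upd_left assms)
  show "diamond_formal i m n x a y \<in> null_formals s (tri (m + n - 1))"
    if "a \<in> null_formals s (rect m n)"
    unfolding diamond_formal_mid
    by (intro fs.subspace_sum[OF sub] fs.subspace_scale[OF sub] push_null_formals[OF _ _ that]
        diamond_entries_PiE diamond_entries_upd_mid assms)
  show "diamond_formal i m n x a y \<in> null_formals s (tri (m + n - 1))"
    if "y \<in> null_formals s (tri n)"
    unfolding diamond_formal_right
    by (intro fs.subspace_sum[OF sub] fs.subspace_scale[OF sub] push_null_formals[OF _ _ that]
        diamond_entries_PiE diamond_entries_upd_right assms)
qed

lemma diamond_tclass: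
  assumes "1 \<le> i" "i \<le> m" "1 \<le> n"
    and "x \<in> formals (tri m)" "a \<in> formals (rect m n)" "y \<in> formals (tri n)"
  shows "diamond s i m n (tclass s (tri m) x) (tclass s (rect m n) a) (tclass s (tri n) y)
    = tclass s (tri (m + n - 1)) (diamond_formal i m n x a y)"
proof -
  have "tclass s (tri (m + n - 1)) (diamond_formal i m n x' a' y')
      = tclass s (tri (m + n - 1)) (diamond_formal i m n x a y)"
    if "x' \<in> tclass s (tri m) x" "a' \<in> tclass s (rect m n) a" "y' \<in> tclass s (tri n) y" for x' a' y'
  proof (rule tclass_eqI)
    \<comment> \<open>The factors are exchanged one after the other, and the three differences
      telescope.\<close>
    have "diamond_formal i m n (x' - x) a' y' + diamond_formal i m n x (a' - a) y'
        + diamond_formal i m n x a (y' - y) \<in> null_formals s (tri (m + n - 1))"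
      using that[THEN tclassD(2)]
      by (intro fs.subspace_add[OF subspace_null_formals] diamond_formal_null assms(1-3))
    then show "diamond_formal i m n x' a' y' - diamond_formal i m n x a y
        \<in> null_formals s (tri (m + n - 1))"
      by (simp add: diamond_formal_diff)
  qed
  then show ?thesis
    unfolding diamond_def by (intro UN_constant_eq[OF tclass_self] ballI assms)
qed

lemma transpose_formal_formals: "transpose_formal m n a \<in> formals (rect n m)"
  unfolding transpose_formal_def
  by (intro fs.subspace_sum[OF subspace_formals] single_in_formals) (simp add: transpose_entries_def)

text \<open>This is one of the ideals intersected in \<open>exterior_ideal\<close>, so it bounds the
  exterior ideal from above.\<close>

lemma is_ideal_TS: "is_ideal s (TS s)"
proof -
  have diamond: "diamond s i m n X A Y \<in> TS s (m + n - 1)"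
    if i: "1 \<le> i" "i \<le> m" "1 \<le> n" and XAY: "X \<in> TS s m" "A \<in> BS s m n" "Y \<in> TS s n" for i m n X A Y
  proof -
    obtain x a y where "x \<in> formals (tri m)" "X = tclass s (tri m) x"
      "a \<in> formals (rect m n)" "A = tclass s (rect m n) a" "y \<in> formals (tri n)" "Y = tclass s (tri n) y"
      using XAY unfolding tensor_power_def by (elim imageE) blast
    then show ?thesis
      unfolding tensor_power_def
      by (simp only: diamond_tclass[OF i] imageI diamond_formal_formals)
  qed
  moreover have "tensor_transpose s m n A \<in> BS s n m" if "A \<in> BS s m n" for m n A
    using that tensor_transpose_tclass transpose_formal_formals by (fastforce simp: tensor_power_def)
  ultimately show ?thesis
    unfolding is_ideal_def using tensor_subspace_tensor_power[of s]
    by (metis add.commute atLeastAtMost_iff)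
qed

lemma exterior_ideal_subset_TS: "exterior_ideal s m \<subseteq> TS s m"
proof -
  have "exterior_generators s l \<subseteq> TS s l" for l
    by (auto simp: exterior_generators_def tensor_power_def simple_tensor_def intro!: imageI single_in_formals)
  then show ?thesis
    unfolding exterior_ideal_def generated_ideal_def using is_ideal_TS by blast
qed

section \<open>Cycles in graphs\<close>

text \<open>The first vertex \<open>p\<close> of a longest path has at least two neighbours, all on
  the path. One of them, \<open>x\<close>, comes after the second vertex \<open>q\<close>, and the
  path from \<open>p\<close> to \<open>x\<close> is closed by the edge back to
  \<open>p\<close>.\<close>

lemma exists_cycle_if_min_degree_2:
  fixes R :: "'a \<Rightarrow> 'a \<Rightarrow> bool"
  assumes "finite V" "V \<noteq> {}" "symp R" "irreflp R"
    and deg: "\<And>p. p \<in> V \<Longrightarrow> 2 \<le> card {q \<in> V. R p q}"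
  shows "\<exists>xs. distinct xs \<and> set xs \<subseteq> V \<and> 3 \<le> length xs \<and> successively R (xs @ [hd xs])"
proof -
  define P where "P xs \<longleftrightarrow> distinct xs \<and> set xs \<subseteq> V \<and> successively R xs \<and> xs \<noteq> []" for xs
  obtain v where "v \<in> V" using assms by blast
  then have "P [v]" by (simp add: P_def)
  moreover have "\<forall>ys. P ys \<longrightarrow> length ys < Suc (card V)"
    using assms(1) by (metis P_def card_mono distinct_card less_Suc_eq_le)
  ultimately have "\<exists>xs. P xs \<and> (\<forall>ys. P ys \<longrightarrow> length ys \<le> length xs)"
    by (rule ex_has_greatest_nat)
  then obtain xs where xs: "P xs" and longest: "\<And>ys. P ys \<Longrightarrow> length ys \<le> length xs"
    by blast
  \<comment> \<open>All neighbours of an end of a longest path lie on the path.\<close>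
  then obtain p rest where pr: "xs = p # rest" by (cases xs) (auto simp: P_def)
  let ?N = "{q \<in> V. R p q}"
  have N: "?N \<subseteq> set rest"
  proof
    fix q assume q: "q \<in> ?N"
    show "q \<in> set rest"
    proof (rule ccontr)
      assume "q \<notin> set rest"
      moreover have "q \<noteq> p" using q \<open>irreflp R\<close> by (auto dest: irreflpD)
      ultimately have "P (q # xs)"
        using xs q \<open>symp R\<close> by (auto simp: P_def pr dest: sympD)
      then show False using longest by force
    qed
  qed
  have "2 \<le> card ?N" using deg xs by (simp add: P_def pr)
  then have "?N \<noteq> {}" by (metis card.empty not_numeral_le_zero)
  then obtain q rest' where rest: "rest = q # rest'" using N by (cases rest) auto
  have "\<not> ?N \<subseteq> {q}" using \<open>2 \<le> card ?N\<close> card_mono[of "{q}" ?N] by auto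
  then obtain x where "x \<in> set rest'" "R p x" using N rest by auto
  then obtain ys zs where split: "rest' = ys @ x # zs" by (meson split_list)
  let ?c = "p # q # ys @ [x]"
  have "successively R (?c @ zs)" using xs by (simp add: P_def pr rest split)
  then have "successively R ?c" by (simp only: successively_append_iff)
  moreover have "R x p" using \<open>R p x\<close> \<open>symp R\<close> by (auto dest: sympD)
  ultimately have "successively R (?c @ [hd ?c])"
    by (subst successively_append_iff) simp
  moreover have "distinct ?c" "set ?c \<subseteq> V" "3 \<le> length ?c"
    using xs by (auto simp: P_def pr rest split)
  ultimately show ?thesis by blast
qed

text \<open>Edges are counted as ordered pairs, hence the factor 2.\<close>

lemma exists_cycle_if_many_edges:
  fixes R :: "'a \<Rightarrow> 'a \<Rightarrow> bool"
  assumes "finite V" "V \<noteq> {}" "symp R" "irreflp R"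
    and "2 * card V \<le> card {(p, q). p \<in> V \<and> q \<in> V \<and> R p q}"
  shows "\<exists>xs. distinct xs \<and> set xs \<subseteq> V \<and> 3 \<le> length xs \<and> successively R (xs @ [hd xs])"
  using assms
proof (induction V rule: finite_psubset_induct)
  case (psubset V)
  let ?E = "\<lambda>V. {(p, q). p \<in> V \<and> q \<in> V \<and> R p q}"
  show ?case
  proof (cases "\<forall>p\<in>V. 2 \<le> card {q \<in> V. R p q}")
    case True
    then show ?thesis
      by (intro exists_cycle_if_min_degree_2 psubset.hyps psubset.prems) simp
  next
    case False
    then obtain v where "v \<in> V" "\<not> 2 \<le> card {q \<in> V. R v q}" by blast
    then have v: "v \<in> V" "card {q \<in> V. R v q} \<le> 1" by simp_all
    \<comment> \<open>Deleting \<open>v\<close>, of degree at most 1, loses one vertex and at most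
      two ordered pairs, so the bound passes to \<open>?W\<close>.\<close>
    let ?N = "{q \<in> V. R v q}" and ?W = "V - {v}"
    have finN: "finite ?N" using psubset.hyps by simp
    have finW: "finite (?E ?W)"
      by (rule finite_subset[of _ "V \<times> V"]) (use psubset.hyps in auto)
    have "?E V \<subseteq> ?E ?W \<union> (Pair v ` ?N \<union> (\<lambda>q. (q, v)) ` ?N)"
      using \<open>symp R\<close> unfolding symp_def by blast
    then have "card (?E V) \<le> card (?E ?W \<union> (Pair v ` ?N \<union> (\<lambda>q. (q, v)) ` ?N))"
      by (intro card_mono finite_UnI finite_imageI finW finN)
    also have "\<dots> \<le> card (?E ?W) + (card (Pair v ` ?N) + card ((\<lambda>q. (q, v)) ` ?N))"
      by (rule order_trans[OF card_Un_le add_left_mono[OF card_Un_le]])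
    also have "\<dots> \<le> card (?E ?W) + 2"
      using card_image_le[OF finN, of "Pair v"] card_image_le[OF finN, of "\<lambda>q. (q, v)"] v(2) by linarith
    finally have le: "card (?E V) \<le> card (?E ?W) + 2" .
    have "card V = card ?W + 1" using card_Suc_Diff1[OF psubset.hyps(1) v(1)] by simp
    with le psubset.prems have "2 * card ?W \<le> card (?E ?W)" by linarith
    \<comment> \<open>A single vertex has no edges since \<open>R\<close> is irreflexive, while the
      bound would demand two ordered pairs.\<close>
    moreover have "?W \<noteq> {}"
    proof
      assume "?W = {}"
      then have "?E V = {}" using \<open>irreflp R\<close> by (auto dest: irreflpD)
      then have "card (?E V) = 0" by (simp only: card.empty)
      then have "card V = 0" using psubset.prems(4) by linarith
      then show False using psubset.prems(1) psubset.hyps by simp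
    qed
    moreover have "?W \<subset> V" using v by blast
    ultimately have "\<exists>xs. distinct xs \<and> set xs \<subseteq> ?W \<and> 3 \<le> length xs \<and> successively R (xs @ [hd xs])"
      by (intro psubset.IH psubset.prems(2,3))
    then show ?thesis by (elim ex_forward) auto
  qed
qed

section \<open>Monochromatic triangles and cycles\<close>

lemma is_ideal_diamond:
  assumes "is_ideal s J" "1 \<le> m" "1 \<le> n" "X \<in> J m" "A \<in> BS s m n" "Y \<in> TS s n" "i \<in> {1..m}"
  shows "diamond s i m n X A Y \<in> J (m + n - 1)"
  using assms unfolding is_ideal_def by blast

lemma exterior_generators_4: "simple_tensor s (tri 4) (\<lambda>_. v) \<in> exterior_generators s 4"
  by (auto simp: exterior_generators_def)

text \<open>The exterior ideal is the intersection of all such \<open>J\<close>, so membership in it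
  can be tested in one arbitrary \<open>J\<close>.\<close>

locale exterior_superideal =
  fixes s :: "'k::field \<Rightarrow> 'v::ab_group_add \<Rightarrow> 'v" and J :: "nat \<Rightarrow> ('k, 'v) tensor set"
  assumes ideal: "is_ideal s J"
    and generators: "\<And>l. 1 \<le> l \<Longrightarrow> exterior_generators s l \<subseteq> J l"
begin

text \<open>Working with formal sums instead of classes makes the ideal an honest subspace.\<close>

definition kernel :: "nat \<Rightarrow> ('k, 'v) formal set" where
  "kernel m = {x \<in> formals (tri m). tclass s (tri m) x \<in> J m}"

lemma subspace_kernel:
  assumes "1 \<le> m"
  shows "fs.subspace (kernel m)"
proof -
  have "tensor_subspace s (tri m) (J m)"
    using ideal assms by (simp add: is_ideal_def)
  then have J: "tclass s (tri m) 0 \<in> J m"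
    "\<And>X Y. X \<in> J m \<Longrightarrow> Y \<in> J m \<Longrightarrow> tadd s (tri m) X Y \<in> J m"
    "\<And>c X. X \<in> J m \<Longrightarrow> tscale s (tri m) c X \<in> J m"
    by (auto simp: tensor_subspace_def tzero_def)
  show ?thesis
  proof (rule fs.subspaceI)
    show "0 \<in> kernel m"
      using J(1) fs.subspace_0[OF subspace_formals] by (simp add: kernel_def)
    show "x + y \<in> kernel m" if "x \<in> kernel m" "y \<in> kernel m" for x y
      using that J(2)[of "tclass s (tri m) x" "tclass s (tri m) y"] fs.subspace_add[OF subspace_formals, of x "tri m" y]
      by (simp add: kernel_def tadd_tclass)
    show "fscale c x \<in> kernel m" if "x \<in> kernel m" for c x
      using that J(3)[of "tclass s (tri m) x" c] fs.subspace_scale[OF subspace_formals, of x "tri m" c]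
      by (simp add: kernel_def tscale_tclass)
  qed
qed

lemma null_in_kernel:
  assumes "1 \<le> m" "x \<in> formals (tri m)" "x \<in> null_formals s (tri m)"
  shows "x \<in> kernel m"
proof -
  have "tclass s (tri m) x = tclass s (tri m) 0"
    using assms by (intro tclass_eqI) simp
  then show ?thesis
    using fs.subspace_0[OF subspace_kernel[OF assms(1)]] assms(2) by (simp add: kernel_def)
qed

section \<open>Multilinearity modulo the ideal\<close>

lemma upd_in_PiE:
  assumes "u \<in> I \<rightarrow>\<^sub>E UNIV" "j \<in> I"
  shows "u(j := a) \<in> I \<rightarrow>\<^sub>E UNIV"
  using assms by (auto simp: PiE_iff extensional_def)

lemma kernel_add:
  assumes "1 \<le> m" "u \<in> tri m \<rightarrow>\<^sub>E UNIV" "j \<in> tri m"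
  shows "Poly_Mapping.single (u(j := a + b)) 1
    - (Poly_Mapping.single (u(j := a)) 1 + Poly_Mapping.single (u(j := b)) 1) \<in> kernel m" (is "?x \<in> _")
proof (rule null_in_kernel[OF assms(1)])
  show "?x \<in> formals (tri m)"
    by (intro fs.subspace_add[OF subspace_formals] fs.subspace_diff[OF subspace_formals]
        single_in_formals upd_in_PiE assms)
  have "?x \<in> multilinear_relations s (tri m)"
    unfolding multilinear_relations_def using assms by blast
  then show "?x \<in> null_formals s (tri m)"
    unfolding null_formals_def by (rule fs.span_base)
qed

lemma kernel_scale:
  assumes "1 \<le> m" "u \<in> tri m \<rightarrow>\<^sub>E UNIV" "j \<in> tri m"
  shows "Poly_Mapping.single (u(j := s c a)) 1
    - fscale c (Poly_Mapping.single (u(j := a)) 1) \<in> kernel m" (is "?x \<in> _")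
proof (rule null_in_kernel[OF assms(1)])
  show "?x \<in> formals (tri m)"
    by (intro fs.subspace_scale[OF subspace_formals] fs.subspace_diff[OF subspace_formals]
        single_in_formals upd_in_PiE assms)
  have "?x \<in> multilinear_relations s (tri m)"
    unfolding multilinear_relations_def using assms by blast
  then show "?x \<in> null_formals s (tri m)"
    unfolding null_formals_def by (rule fs.span_base)
qed

text \<open>The sum and scalar relations are merged into the form that polarization at
  \<open>a + s c b\<close> uses.\<close>

lemma kernel_linear:
  assumes "1 \<le> m" "u \<in> tri m \<rightarrow>\<^sub>E UNIV" "j \<in> tri m"
  shows "Poly_Mapping.single (u(j := a + s c b)) 1
    - (Poly_Mapping.single (u(j := a)) 1 + fscale c (Poly_Mapping.single (u(j := b)) 1)) \<in> kernel m"
  using fs.subspace_add[OF subspace_kernel[OF assms(1)] kernel_add[OF assms, of a "s c b"]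
      kernel_scale[OF assms, of c b]]
  by (simp add: algebra_simps)

text \<open>The entries \<open>u\<close> are \<open>\<diamond>\<^sub>t\<close> of their restriction to the vertices other than \<open>t\<close>, with \<open>\<T>(2)\<close> in the last slot.\<close>

lemma insert_vertex:
  assumes u: "u \<in> tri (n + 2) \<rightarrow>\<^sub>E UNIV" and t: "t \<in> {1..n + 1}"
    and minor: "Poly_Mapping.single
        (restrict (\<lambda>(a, b). u (old_index t 2 a, old_index t 2 b)) (tri (n + 1))) 1 \<in> kernel (n + 1)"
  shows "Poly_Mapping.single u 1 \<in> kernel (n + 2)"
proof -
  let ?x = "restrict (\<lambda>(a, b). u (old_index t 2 a, old_index t 2 b)) (tri (n + 1))"
  \<comment> \<open>Arity 2 in the last factor inserts the single vertex \<open>t\<close>: the one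
    column of \<open>?w\<close> holds the labels of the edges at \<open>t\<close>, and
    \<open>?y\<close> has no entries.\<close>
  let ?w = "restrict (\<lambda>(a, b). u (min (old_index t 2 a) t, max (old_index t 2 a) t)) (rect (n + 1) 2)"
  let ?y = "restrict u (tri 2)"
  have tri: "tri 2 = {}" by (auto simp: tri_def)
  have forms: "Poly_Mapping.single ?x 1 \<in> formals (tri (n + 1))"
    "Poly_Mapping.single ?w 1 \<in> formals (rect (n + 1) 2)"
    "Poly_Mapping.single ?y 1 \<in> formals (tri 2)"
    by (intro single_in_formals; simp)+
  have new: "new_index t 2 p \<longleftrightarrow> p = t" for p by (auto simp: new_index_def)
  have old: "old_index t 2 (old_pos t 2 p) = p" if "p \<noteq> t" for p
    using that t by (auto simp: old_index_def old_pos_def)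
  have "diamond_entries t (n + 1) 2 ?x ?w ?y = u"
  proof
    fix pq :: "nat \<times> nat"
    obtain p q where pq: "pq = (p, q)" by force
    show "diamond_entries t (n + 1) 2 ?x ?w ?y pq = u pq"
    proof (cases "pq \<in> tri (n + 1 + 2 - 1)")
      case True
      then have pq': "1 \<le> p" "p < q" "q \<le> n + 1" by (auto simp: tri_def pq)
      note D = diamond_entries_apply[OF True[unfolded pq], of t, unfolded new]
      consider "p \<noteq> t" "q \<noteq> t" | "p \<noteq> t" "q = t" | "p = t" "q \<noteq> t" using pq' by auto
      then show ?thesis
      proof cases
        case 1
        then have "(old_pos t 2 p, old_pos t 2 q) \<in> tri (n + 1)"
          using pq' t by (auto simp: tri_def old_pos_def)
        then show ?thesis unfolding pq D(1)[OF 1] by (simp add: old 1)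
      next
        case 2
        then have "(old_pos t 2 p, q - t + 1) \<in> rect (n + 1) 2"
          using pq' t by (auto simp: rect_def old_pos_def)
        then show ?thesis unfolding pq D(3)[OF 2] using pq' by (simp add: old 2 min_def max_def)
      next
        case 3
        then have "(old_pos t 2 q, p - t + 1) \<in> rect (n + 1) 2"
          using pq' t by (auto simp: rect_def old_pos_def)
        then show ?thesis unfolding pq D(4)[OF 3] using pq' by (simp add: old 3 min_def max_def)
      qed
    next
      case False
      then have "pq \<notin> tri (n + 2)" by simp
      then have "u pq = undefined" using u by (simp add: PiE_iff extensional_def pq)
      then show ?thesis using diamond_entries_outside[OF False] by simp
    qed
  qed
  then have "diamond s t (n + 1) 2 (tclass s (tri (n + 1)) (Poly_Mapping.single ?x 1))
      (tclass s (rect (n + 1) 2) (Poly_Mapping.single ?w 1)) (tclass s (tri 2) (Poly_Mapping.single ?y 1))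
      = tclass s (tri (n + 2)) (Poly_Mapping.single u 1)"
    using diamond_tclass[OF _ _ _ forms, of t s] t by (simp add: diamond_formal_single)
  moreover have "diamond s t (n + 1) 2 (tclass s (tri (n + 1)) (Poly_Mapping.single ?x 1))
      (tclass s (rect (n + 1) 2) (Poly_Mapping.single ?w 1)) (tclass s (tri 2) (Poly_Mapping.single ?y 1))
      \<in> J (n + 1 + 2 - 1)"
  proof (rule is_ideal_diamond[OF ideal])
    show "tclass s (tri (n + 1)) (Poly_Mapping.single ?x 1) \<in> J (n + 1)"
      using minor by (simp add: kernel_def)
    show "tclass s (rect (n + 1) 2) (Poly_Mapping.single ?w 1) \<in> BS s (n + 1) 2"
      "tclass s (tri 2) (Poly_Mapping.single ?y 1) \<in> TS s 2"
      unfolding tensor_power_def by (intro imageI forms)+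
  qed (use t in auto)
  ultimately show ?thesis
    using single_in_formals[OF u] by (simp add: kernel_def)
qed

text \<open>Induction on the number of vertices. On three vertices the labelling is a generator.
  Otherwise a vertex \<open>t\<close> off the triangle is deleted, renumbering preserves the order
  of the others, and \<open>insert_vertex\<close> restores \<open>t\<close>.\<close>

lemma triangle_in_kernel_ordered:
  assumes "3 \<le> n" "u \<in> tri (n + 1) \<rightarrow>\<^sub>E UNIV" "1 \<le> p" "p < q" "q < r" "r \<le> n"
    and "u (p, q) = v" "u (p, r) = v" "u (q, r) = v"
  shows "Poly_Mapping.single u 1 \<in> kernel (n + 1)"
  using assms
proof (induction n arbitrary: u p q r rule: nat_induct_at_least)
  case base
  then have pqr: "p = 1" "q = 2" "r = 3" by auto
  have "u = restrict (\<lambda>_. v) (tri 4)"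
  proof
    fix ab :: "nat \<times> nat"
    obtain a b where ab: "ab = (a, b)" by force
    show "u ab = restrict (\<lambda>_. v) (tri 4) ab"
    proof (cases "ab \<in> tri 4")
      case True
      then have "ab = (p, q) \<or> ab = (p, r) \<or> ab = (q, r)"
        unfolding ab pqr tri_def by auto
      then show ?thesis using True base by auto
    next
      case False
      then show ?thesis using base.prems(1) by (simp add: PiE_iff extensional_def ab)
    qed
  qed
  then have "tclass s (tri 4) (Poly_Mapping.single u 1) \<in> J 4"
    using generators[of 4] exterior_generators_4[of s v] unfolding simple_tensor_def by auto
  then show ?case
    using single_in_formals[OF base.prems(1)] by (simp add: kernel_def)
next
  case (Suc n)
  have "card {p, q, r} \<le> 3" by (simp add: card_insert_if)
  then have "\<not> {1..n + 1} \<subseteq> {p, q, r}"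
    using Suc.hyps card_mono[of "{p, q, r}" "{1..n + 1}"] by auto
  then obtain t where "t \<in> {1..n + 1}" "t \<notin> {p, q, r}" by blast
  then have t: "t \<in> {1..n + 1}" "t \<noteq> p" "t \<noteq> q" "t \<noteq> r" by simp_all
  let ?o = "old_pos t 2"
  let ?x = "restrict (\<lambda>(a, b). u (old_index t 2 a, old_index t 2 b)) (tri (n + 1))"
  have old: "old_index t 2 (old_pos t 2 p) = p" if "p \<noteq> t" for p
    using that t by (auto simp: old_index_def old_pos_def)
  have o: "1 \<le> ?o p" "?o p < ?o q" "?o q < ?o r" "?o r \<le> n"
    using t Suc.prems by (auto simp: old_pos_def)
  then have "(?o p, ?o q) \<in> tri (n + 1)" "(?o p, ?o r) \<in> tri (n + 1)" "(?o q, ?o r) \<in> tri (n + 1)"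
    by (auto simp: tri_def)
  then have "Poly_Mapping.single ?x 1 \<in> kernel (n + 1)"
    using t Suc.prems old by (intro Suc.IH[OF _ o]) auto
  then show ?case
    using insert_vertex[of u n t] Suc.prems(1) t(1) by simp
qed

text \<open>Labels live only above the diagonal; sorting the endpoints frees triangles and cycles
  from the numbering of their vertices.\<close>

definition edge :: "nat \<Rightarrow> nat \<Rightarrow> nat \<times> nat" where
  "edge p q = (min p q, max p q)"

lemma edge_commute: "edge p q = edge q p"
  by (simp add: edge_def min.commute max.commute)

lemma edge_eq_iff: "edge p q = edge x y \<longleftrightarrow> (p = x \<and> q = y) \<or> (p = y \<and> q = x)"
  by (auto simp: edge_def min_def max_def)

lemma edge_in_tri: "p \<noteq> q \<Longrightarrow> p \<in> {1..n} \<Longrightarrow> q \<in> {1..n} \<Longrightarrow> edge p q \<in> tri (n + 1)"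
  by (auto simp: edge_def tri_def)

lemma triangle_in_kernel:
  assumes u: "u \<in> tri (n + 1) \<rightarrow>\<^sub>E UNIV" and pqr: "distinct [p, q, r]" "{p, q, r} \<subseteq> {1..n}"
    and v: "u (edge p q) = v" "u (edge q r) = v" "u (edge p r) = v"
  shows "Poly_Mapping.single u 1 \<in> kernel (n + 1)"
proof -
  have n: "3 \<le> n"
    using card_mono[OF _ pqr(2)] pqr(1) by simp
  have edge: "a < b \<Longrightarrow> edge a b = (a, b)" for a b by (simp add: edge_def)
  have *: "Poly_Mapping.single u 1 \<in> kernel (n + 1)"
    if "a < b" "b < c" "1 \<le> a" "c \<le> n" "u (edge a b) = v" "u (edge b c) = v" "u (edge a c) = v" for a b c
    using triangle_in_kernel_ordered[OF n u] that by (simp add: edge)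
  have b: "1 \<le> p" "1 \<le> q" "1 \<le> r" "p \<le> n" "q \<le> n" "r \<le> n" using pqr(2) by auto
  \<comment> \<open>The condition on the labels is symmetric in the three vertices, so each of the
    six orders is an instance of \<open>*\<close>.\<close>
  consider "p < q" "q < r" | "p < r" "r < q" | "q < p" "p < r" | "q < r" "r < p" | "r < p" "p < q" | "r < q" "q < p"
    using pqr(1) by (metis distinct_length_2_or_more linorder_neqE_nat)
  then show ?thesis
    by cases (use *[of p q r] *[of p r q] *[of q p r] *[of q r p] *[of r p q] *[of r q p] v b edge_commute in metis)+
qed

end

text \<open>
  Expanding \<open>T v v v\<close> at \<open>v = a + c b\<close> yields \<open>c P + c\<^sup>2 Q \<in> N\<close> with the mixed parts \<open>P\<close>, \<open>Q\<close>
  of degree 1 and 2 in \<open>b\<close>; comparing \<open>c = 1\<close> with some \<open>c \<noteq> 0, 1\<close> isolates \<open>P\<close>.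
\<close>

lemma polarize:
  fixes T :: "'v::ab_group_add \<Rightarrow> 'v \<Rightarrow> 'v \<Rightarrow> ('k::field, 'w) formal"
  assumes N: "fs.subspace N"
    and T1: "\<And>c x y. T (a + s c b) x y - (T a x y + fscale c (T b x y)) \<in> N"
    and T2: "\<And>c x y. T x (a + s c b) y - (T x a y + fscale c (T x b y)) \<in> N"
    and T3: "\<And>c x y. T x y (a + s c b) - (T x y a + fscale c (T x y b)) \<in> N"
    and diag: "\<And>v. T v v v \<in> N"
    and k: "card (UNIV :: 'k set) \<noteq> 2"
  shows "T a a b + T a b a + T b a a \<in> N"
proof -
  note add = fs.subspace_add[OF N] and diff = fs.subspace_diff[OF N] and scale = fs.subspace_scale[OF N]
  define P where "P = T a a b + T a b a + T b a a"
  define Q where "Q = T a b b + T b a b + T b b a"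
  have PQ: "fscale c P + fscale (c * c) Q \<in> N" for c
  proof -
    \<comment> \<open>The slots are expanded from left to right, with 1, 2 and 4 linearity
      relations, each weighted by the power of \<open>c\<close> collected so far. The pure terms
      \<open>T a a a\<close> and \<open>T b b b\<close> lie in \<open>N\<close> by
      \<open>diag\<close>.\<close>
    let ?v = "a + s c b"
    have "T ?v ?v ?v - fscale (c * c * c) (T b b b) - T a a a
      - ((T ?v ?v ?v - (T a ?v ?v + fscale c (T b ?v ?v)))
        + (T a ?v ?v - (T a a ?v + fscale c (T a b ?v)))
        + fscale c (T b ?v ?v - (T b a ?v + fscale c (T b b ?v)))
        + (T a a ?v - (T a a a + fscale c (T a a b)))
        + fscale c (T a b ?v - (T a b a + fscale c (T a b b)))
        + fscale c (T b a ?v - (T b a a + fscale c (T b a b)))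
        + fscale (c * c) (T b b ?v - (T b b a + fscale c (T b b b)))) \<in> N"
      by (intro add diff scale T1 T2 T3 diag)
    also have "T ?v ?v ?v - fscale (c * c * c) (T b b b) - T a a a
      - ((T ?v ?v ?v - (T a ?v ?v + fscale c (T b ?v ?v)))
        + (T a ?v ?v - (T a a ?v + fscale c (T a b ?v)))
        + fscale c (T b ?v ?v - (T b a ?v + fscale c (T b b ?v)))
        + (T a a ?v - (T a a a + fscale c (T a a b)))
        + fscale c (T a b ?v - (T a b a + fscale c (T a b b)))
        + fscale c (T b a ?v - (T b a a + fscale c (T b a b)))
        + fscale (c * c) (T b b ?v - (T b b a + fscale c (T b b b)))) = fscale c P + fscale (c * c) Q"
      by (simp add: P_def Q_def fs.scale_right_distrib fs.scale_right_diff_distrib algebra_simps)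
    finally show ?thesis .
  qed
  \<comment> \<open>As \<open>card\<close> is 0 on an infinite field, \<open>k\<close> excludes just
    the case of two elements.\<close>
  obtain c :: 'k where c: "c \<noteq> 0" "c \<noteq> 1"
  proof (rule ccontr)
    assume "\<not> thesis"
    then have "(UNIV :: 'k set) = {0, 1}" using that by auto
    then show False using k by (metis card_2_iff zero_neq_one)
  qed
  \<comment> \<open>The relation for the scalar 1, multiplied by \<open>c * c\<close>, has the same
    \<open>Q\<close> term as the relation for \<open>c\<close>, so \<open>Q\<close> cancels.\<close>
  have "fscale (c * c) P + fscale (c * c) Q \<in> N"
    using scale[OF PQ[of 1], of "c * c"] by (simp add: fs.scale_right_distrib)
  then have "(fscale (c * c) P + fscale (c * c) Q) - (fscale c P + fscale (c * c) Q) \<in> N"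
    by (rule diff[OF _ PQ])
  then have "fscale (c * c - c) P \<in> N"
    by (simp add: fs.scale_left_diff_distrib)
  then have "fscale (inverse (c * c - c)) (fscale (c * c - c) P) \<in> N" by (rule scale)
  moreover have "c * c - c \<noteq> 0" using c by simp
  ultimately show ?thesis by (simp add: P_def)
qed

context exterior_superideal
begin

lemma triangle_relation:
  assumes k: "card (UNIV :: 'k set) \<noteq> 2"
    and u: "u \<in> tri (n + 1) \<rightarrow>\<^sub>E UNIV" and pqr: "distinct [p, q, r]" "{p, q, r} \<subseteq> {1..n}"
    and T: "\<And>x y z. T x y z = Poly_Mapping.single (u(edge p q := x, edge q r := y, edge p r := z)) 1"
  shows "T a a b + T a b a + T b a a \<in> kernel (n + 1)"
proof (rule polarize[of _ T a s b, OF subspace_kernel _ _ _ _ k])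
  have e: "edge p q \<in> tri (n + 1)" "edge q r \<in> tri (n + 1)" "edge p r \<in> tri (n + 1)"
    using pqr by (intro edge_in_tri; force)+
  have ne: "edge p q \<noteq> edge q r" "edge p q \<noteq> edge p r" "edge q r \<noteq> edge p r"
    using pqr(1) by (auto simp: edge_eq_iff)
  have mem: "u(edge p q := x, edge q r := y, edge p r := z) \<in> tri (n + 1) \<rightarrow>\<^sub>E UNIV" for x y z
    by (intro upd_in_PiE u e)
  show "T x y (a + s c b) - (T x y a + fscale c (T x y b)) \<in> kernel (n + 1)" for c x y
    unfolding T by (intro kernel_linear upd_in_PiE u e) simp
  \<comment> \<open>\<open>kernel_linear\<close> varies the outermost update. The three edges are
    distinct, so the updates may be reordered to bring the slot in question last.\<close>
  have T': "T x y z = Poly_Mapping.single (u(edge p q := x, edge p r := z, edge q r := y)) 1" for x y z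
    unfolding T using ne by (simp add: fun_upd_twist)
  show "T x (a + s c b) y - (T x a y + fscale c (T x b y)) \<in> kernel (n + 1)" for c x y
    unfolding T' by (intro kernel_linear upd_in_PiE u e) simp
  have T'': "T x y z = Poly_Mapping.single (u(edge q r := y, edge p r := z, edge p q := x)) 1" for x y z
    unfolding T using ne by (auto simp: fun_upd_def intro!: arg_cong[of _ _ "\<lambda>f. Poly_Mapping.single f 1"])
  show "T (a + s c b) x y - (T a x y + fscale c (T b x y)) \<in> kernel (n + 1)" for c x y
    unfolding T'' by (intro kernel_linear upd_in_PiE u e) simp
  show "T v v v \<in> kernel (n + 1)" for v
    unfolding T by (rule triangle_in_kernel[OF mem pqr]) (use ne in auto)
qed simp

text \<open>The induction must range over all labellings: the shortcut from \<open>p\<close> to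
  \<open>r\<close> relabels the edges joining \<open>q\<close> to \<open>p\<close> and
  \<open>r\<close>. These are off the shorter cycle, so their new labels are arbitrary.\<close>

lemma cycle_in_kernel:
  assumes k: "card (UNIV :: 'k set) \<noteq> 2"
    and "u \<in> tri (n + 1) \<rightarrow>\<^sub>E UNIV" "distinct xs" "set xs \<subseteq> {1..n}" "3 \<le> length xs"
    and "successively (\<lambda>p q. u (edge p q) = a) (xs @ [hd xs])"
  shows "Poly_Mapping.single u 1 \<in> kernel (n + 1)"
  using assms(2-)
proof (induction "length xs" arbitrary: xs u rule: less_induct)
  case less
  obtain p q r ys where xs: "xs = p # q # r # ys"
    using \<open>3 \<le> length xs\<close> by (metis Suc_le_length_iff numeral_3_eq_3)
  have pqr: "distinct [p, q, r]" "{p, q, r} \<subseteq> {1..n}"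
    using less.prems xs by auto
  have ne: "edge p q \<noteq> edge q r" "edge p q \<noteq> edge p r" "edge q r \<noteq> edge p r"
    using pqr(1) by (auto simp: edge_eq_iff)
  have pq: "u (edge p q) = a" and qr: "u (edge q r) = a"
    using less.prems(5) by (simp_all add: xs)
  show ?case
  proof (cases ys)
    case Nil
    then have "u (edge p r) = a" using less.prems(5) by (simp add: xs edge_commute)
    then show ?thesis using triangle_in_kernel[OF less.prems(1) pqr pq qr] by blast
  next
    case (Cons z zs)
    define T where "T x y w = Poly_Mapping.single (u(edge p q := x, edge q r := y, edge p r := w)) (1::'k)" for x y w
    let ?b = "u (edge p r)"
    have shorter: "T x y a \<in> kernel (n + 1)" for x y
      unfolding T_def
    proof (rule less.hyps[of "p # r # ys"])
      let ?u = "u(edge p q := x, edge q r := y, edge p r := a)"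
      have "successively (\<lambda>p q. u (edge p q) = a) (z # zs @ [p])" "u (edge r z) = a"
        using less.prems(5) by (simp_all add: xs Cons)
      moreover have "?u (edge v w) = u (edge v w)" if "v \<in> insert p (set ys)" "w \<in> insert p (set ys)" for v w
        using that less.prems(2) by (auto simp: xs edge_eq_iff)
      moreover have "?u (edge r z) = u (edge r z)"
        using less.prems(2) by (auto simp: xs Cons edge_eq_iff)
      ultimately have "successively (\<lambda>p q. ?u (edge p q) = a) (z # zs @ [p])" "?u (edge r z) = a"
        by (auto simp: Cons simp del: fun_upd_apply elim!: successively_mono)
      then show "successively (\<lambda>p q. ?u (edge p q) = a) ((p # r # ys) @ [hd (p # r # ys)])"
        by (simp add: Cons del: fun_upd_apply) simp
      show "?u \<in> tri (n + 1) \<rightarrow>\<^sub>E UNIV"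
        by (intro upd_in_PiE edge_in_tri less.prems(1)) (use pqr in auto)
    qed (use less.prems in \<open>auto simp: xs Cons\<close>)
    \<comment> \<open>\<open>T a a ?b\<close> is \<open>u\<close> itself. The other two terms of the
      triangle relation carry \<open>a\<close> on the shortcut and are covered by
      \<open>shorter\<close>.\<close>
    have "T a a ?b = (T a a ?b + T a ?b a + T ?b a a) - T a ?b a - T ?b a a"
      by simp
    also have "\<dots> \<in> kernel (n + 1)"
      by (intro fs.subspace_diff[OF subspace_kernel] shorter
          triangle_relation[OF k less.prems(1) pqr T_def]) simp_all
    finally have "T a a ?b \<in> kernel (n + 1)" .
    moreover have "u(edge p q := a, edge q r := a, edge p r := ?b) = u"
      using pq qr by (simp add: fun_upd_idem_iff[THEN iffD2] fun_upd_triv)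
    ultimately show ?thesis by (simp add: T_def)
  qed
qed

end

section \<open>Reduction to a basis\<close>

lemma sum_single: "(\<Sum>u\<in>Poly_Mapping.keys x. Poly_Mapping.single u (Poly_Mapping.lookup x u)) = x"
  by (rule poly_mapping_eqI) (simp add: lookup_sum lookup_single when_def in_keys_iff)

lemma finite_tri [simp]: "finite (tri m)"
  by (rule finite_subset[of _ "{1..m} \<times> {1..m}"]) (auto simp: tri_def)

context exterior_superideal
begin

text \<open>\<open>F\<close> holds the positions whose labels are unrestricted. To free one more
  position \<open>j\<close>, note that the vectors admissible at \<open>j\<close> form a subspace
  \<open>?W\<close> containing the spanning set.\<close>

lemma kernel_if_basis:
  assumes vs: "vector_space s" and span: "module.span s Basis = UNIV" and m: "1 \<le> m"
    and basis: "\<And>u. u \<in> tri m \<rightarrow>\<^sub>E Basis \<Longrightarrow> Poly_Mapping.single u 1 \<in> kernel m"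
    and u: "u \<in> tri m \<rightarrow>\<^sub>E UNIV"
  shows "Poly_Mapping.single u 1 \<in> kernel m"
proof -
  interpret vector_space s by (rule vs)
  note sub = subspace_kernel[OF m]
  have "Poly_Mapping.single u 1 \<in> kernel m"
    if "finite F" "F \<subseteq> tri m" "u \<in> tri m \<rightarrow>\<^sub>E UNIV" "\<forall>j\<in>tri m - F. u j \<in> Basis" for F u
    using that
  proof (induction F arbitrary: u rule: finite_induct)
    case empty
    then show ?case by (intro basis) (auto simp: PiE_iff)
  next
    case (insert j F)
    then have j: "j \<in> tri m" by simp
    let ?W = "{a. Poly_Mapping.single (u(j := a)) 1 \<in> kernel m}"
    have "subspace ?W"
    proof (rule subspaceI; clarify)
      show "Poly_Mapping.single (u(j := 0)) 1 \<in> kernel m"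
        using kernel_scale[OF m insert.prems(2) j, of 0 0] by simp
      show "Poly_Mapping.single (u(j := a + b)) 1 \<in> kernel m"
        if "Poly_Mapping.single (u(j := a)) 1 \<in> kernel m" "Poly_Mapping.single (u(j := b)) 1 \<in> kernel m" for a b
        using fs.subspace_add[OF sub kernel_add[OF m insert.prems(2) j, of a b]
            fs.subspace_add[OF sub that]] by simp
      show "Poly_Mapping.single (u(j := s c a)) 1 \<in> kernel m"
        if "Poly_Mapping.single (u(j := a)) 1 \<in> kernel m" for c a
        using fs.subspace_add[OF sub kernel_scale[OF m insert.prems(2) j, of c a]
            fs.subspace_scale[OF sub that, of c]] by simp
    qed
    moreover have "Basis \<subseteq> ?W"
    proof clarify
      fix a assume "a \<in> Basis"
      then show "Poly_Mapping.single (u(j := a)) 1 \<in> kernel m"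
        using insert.prems j by (intro insert.IH upd_in_PiE) auto
    qed
    ultimately have "?W = UNIV" using span span_minimal by blast
    then have "Poly_Mapping.single (u(j := u j)) 1 \<in> kernel m" by blast
    then show ?case by simp
  qed
  from this[OF finite_tri order_refl u] show ?thesis by simp
qed

lemma basis_family_in_kernel:
  assumes k: "card (UNIV :: 'k set) \<noteq> 2"
    and fin: "finite Basis" and n: "2 * card Basis < n" "2 \<le> n"
    and u: "u \<in> tri (n + 1) \<rightarrow>\<^sub>E Basis"
  shows "Poly_Mapping.single u 1 \<in> kernel (n + 1)"
proof -
  let ?V = "{1..n}" and ?d = "card Basis"
  let ?R = "\<lambda>c p q. p \<noteq> q \<and> u (edge p q) = c"
  let ?E = "\<lambda>c. {(p, q). p \<in> ?V \<and> q \<in> ?V \<and> ?R c p q}"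
  have "\<exists>c\<in>Basis. 2 * n \<le> card (?E c)"
  proof (rule ccontr)
    assume "\<not> ?thesis"
    then have small: "card (?E c) \<le> 2 * n - 1" if "c \<in> Basis" for c using that by force
    have "?V \<times> ?V - Id_on ?V \<subseteq> (\<Union>c\<in>Basis. ?E c)"
    proof
      fix pq assume "pq \<in> ?V \<times> ?V - Id_on ?V"
      then obtain p q where pq: "pq = (p, q)" "p \<in> ?V" "q \<in> ?V" "p \<noteq> q" by (cases pq) (auto simp: Id_on_iff)
      then have "u (edge p q) \<in> Basis" by (intro PiE_mem[OF u] edge_in_tri)
      with pq show "pq \<in> (\<Union>c\<in>Basis. ?E c)" by (intro UN_I[of "u (edge p q)"]) simp_all
    qed
    moreover have "finite (\<Union>c\<in>Basis. ?E c)"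
      by (rule finite_subset[of _ "?V \<times> ?V"]) auto
    ultimately have "card (?V \<times> ?V - Id_on ?V) \<le> card (\<Union>c\<in>Basis. ?E c)"
      by (rule card_mono[rotated])
    also have "\<dots> \<le> (\<Sum>c\<in>Basis. card (?E c))" by (rule card_UN_le[OF fin])
    also have "\<dots> \<le> ?d * (2 * n - 1)" using sum_bounded_above[of Basis, OF small] by simp
    also have "card (?V \<times> ?V - Id_on ?V) = n * n - n"
    proof -
      have Id: "Id_on ?V = (\<lambda>p. (p, p)) ` ?V" by auto
      then have "card (Id_on ?V) = n" by (simp add: card_image inj_on_def)
      moreover have "finite (Id_on ?V)" unfolding Id by simp
      moreover have "Id_on ?V \<subseteq> ?V \<times> ?V" by auto
      ultimately show ?thesis by (simp add: card_Diff_subset)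
    qed
    finally have le: "n * n - n \<le> ?d * (2 * n - 1)" .
    \<comment> \<open>Since \<open>2 * ?d \<le> n - 1\<close>, there are at least
      \<open>2 * ?d * n\<close> ordered pairs, which exceeds \<open>?d * (2 * n - 1)\<close> unless
      \<open>?d\<close> is 0. In that case \<open>le\<close> allows no pairs, although
      \<open>2 \<le> n\<close> provides some.\<close>
    have "n * n - n = (n - 1) * n" by (simp add: diff_mult_distrib)
    moreover have "2 * ?d * n \<le> (n - 1) * n" using n by (intro mult_le_mono1) simp
    ultimately have "2 * ?d * n \<le> ?d * (2 * n - 1)" using le by linarith
    moreover have "?d * (2 * n - 1) < ?d * (2 * n)" if "0 < ?d"
      using that n(2) by (intro mult_strict_left_mono) simp_all
    moreover have "?d * (2 * n) = 2 * ?d * n" by simp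
    ultimately have "?d = 0" by linarith
    with le show False using n by simp
  qed
  then obtain c where "2 * n \<le> card (?E c)" by blast
  then have c: "2 * card ?V \<le> card (?E c)" by simp
  have "symp (?R c)" "irreflp (?R c)"
    by (auto simp: symp_def irreflp_def edge_commute)
  moreover have "?V \<noteq> {}" using n(2) by simp
  ultimately have "\<exists>xs. distinct xs \<and> set xs \<subseteq> ?V \<and> 3 \<le> length xs \<and> successively (?R c) (xs @ [hd xs])"
    by (intro exists_cycle_if_many_edges c finite_atLeastAtMost)
  then obtain xs where
    xs: "distinct xs" "set xs \<subseteq> ?V" "3 \<le> length xs" "successively (?R c) (xs @ [hd xs])"
    by (elim exE conjE)
  have "successively (\<lambda>p q. u (edge p q) = c) (xs @ [hd xs])"
    by (rule successively_mono[OF xs(4)]) simp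
  moreover have "u \<in> tri (n + 1) \<rightarrow>\<^sub>E UNIV" using u by (auto simp: PiE_iff)
  ultimately show ?thesis using cycle_in_kernel[OF k _ xs(1-3)] by blast
qed

lemma TS_subset_superideal:
  assumes "finite_dimensional_vector_space s Basis" "card (UNIV :: 'k set) \<noteq> 2"
    and "2 * card Basis < n" "2 \<le> n"
  shows "TS s (n + 1) \<subseteq> J (n + 1)"
proof -
  interpret finite_dimensional_vector_space s Basis by (rule assms(1))
  have m: "1 \<le> n + 1" by simp
  have single: "Poly_Mapping.single u 1 \<in> kernel (n + 1)" if "u \<in> tri (n + 1) \<rightarrow>\<^sub>E UNIV" for u
    using basis_family_in_kernel[OF assms(2) finite_Basis assms(3,4)] that
    by (rule kernel_if_basis[OF vector_space_axioms span_Basis m])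
  have "x \<in> kernel (n + 1)" if "x \<in> formals (tri (n + 1))" for x
  proof -
    \<comment> \<open>Every formal sum is the combination of its families, so \<open>single\<close>
      suffices.\<close>
    have "(\<Sum>u\<in>Poly_Mapping.keys x. fscale (Poly_Mapping.lookup x u) (Poly_Mapping.single u 1)) \<in> kernel (n + 1)"
    proof (intro fs.subspace_sum[OF subspace_kernel[OF m]] fs.subspace_scale[OF subspace_kernel[OF m]] single)
      show "u \<in> tri (n + 1) \<rightarrow>\<^sub>E UNIV" if "u \<in> Poly_Mapping.keys x" for u
        using that \<open>x \<in> formals _\<close> unfolding formals_def by blast
    qed
    then show ?thesis by (simp add: sum_single)
  qed
  then show ?thesis by (auto simp: tensor_power_def kernel_def)
qed

end

section \<open>From the ideal to the quotient\<close>

lemma exterior_ideal_eq_TS: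
  fixes s :: "'k::field \<Rightarrow> 'v::ab_group_add \<Rightarrow> 'v"
  assumes "finite_dimensional_vector_space s Basis" "card (UNIV :: 'k set) \<noteq> 2"
    and "2 * card Basis < n" "2 \<le> n"
  shows "exterior_ideal s (n + 1) = TS s (n + 1)"
proof
  have "TS s (n + 1) \<subseteq> J (n + 1)" if "is_ideal s J" "\<forall>l\<ge>1. exterior_generators s l \<subseteq> J l" for J
  proof -
    interpret exterior_superideal s J using that by unfold_locales auto
    show ?thesis by (rule TS_subset_superideal[OF assms])
  qed
  then show "TS s (n + 1) \<subseteq> exterior_ideal s (n + 1)"
    unfolding exterior_ideal_def generated_ideal_def by blast
qed (rule exterior_ideal_subset_TS)

text \<open>Translation by a fixed element is invertible on the whole space, which is thus its own
  only coset.\<close>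

lemma tadd_image_tensor_power:
  assumes "X \<in> tensor_power s I"
  shows "tadd s I X ` tensor_power s I = tensor_power s I"
proof -
  obtain x where x: "x \<in> formals I" "X = tclass s I x"
    using assms unfolding tensor_power_def by blast
  have "tadd s I X ` tensor_power s I = (\<lambda>y. tclass s I (x + y)) ` formals I"
    unfolding tensor_power_def image_image x(2) by (intro image_cong refl tadd_tclass x(1))
  also have "\<dots> = tclass s I ` (+) x ` formals I"
    by (simp add: image_image)
  also have "(+) x ` formals I = formals I"
  proof
    show "(+) x ` formals I \<subseteq> formals I"
      using fs.subspace_add[OF subspace_formals x(1)] by blast
    show "formals I \<subseteq> (+) x ` formals I"
      using fs.subspace_diff[OF subspace_formals _ x(1)] by (auto intro!: image_eqI[of y "(+) x" "y - x" for y])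
  qed
  finally show ?thesis by (simp add: tensor_power_def)
qed

text \<open>The pair \<open>(0, 1)\<close> is excluded because \<open>TS s 2\<close> is
  one-dimensional for every space, while the generators have degree 4 and the operations never lower
  the degree. In all other cases \<open>n\<close> is at least 2, as the counting argument requires.
  The condition on \<open>card\<close> serves polarization.\<close>

theorem proposition3p2:
  fixes s :: "'k::field \<Rightarrow> 'v::ab_group_add \<Rightarrow> 'v"
    and Basis :: "'v set"
    and d n :: nat
  assumes "finite_dimensional_vector_space s Basis"
    and "vector_space.dim s (UNIV :: 'v set) = d"
    and "n > 2 * d"
    and "card (UNIV :: 'k set) \<noteq> 2"
    and "(d, n) \<noteq> (0, 1)"
  shows "exterior_operad s (n + 1) = {exterior_ideal s (n + 1)}"
proof -
  interpret finite_dimensional_vector_space s Basis by (rule assms(1))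
  have "card Basis = d" using assms(2) dim_UNIV by simp
  then have n: "2 * card Basis < n" "2 \<le> n" using assms(3,5) by auto
  note eq = exterior_ideal_eq_TS[OF assms(1,4) n]
  \<comment> \<open>All cosets coincide; a tensor is exhibited so that the set of cosets is a
    singleton and not empty.\<close>
  have "tzero s (tri (n + 1)) \<in> TS s (n + 1)"
    using tensor_subspace_tensor_power[of s] by (auto simp: tensor_subspace_def)
  then show ?thesis
    unfolding exterior_operad_def eq by (auto simp: tadd_image_tensor_power)
qed

end
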